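(* Let $\mathcal X=\{\theta\}\cup\{X(i)\}_{i\in[0,1]}$ be a Gaussian BCE under some (unknown) payoff structure. Let $\hat\theta_1\neq\hat\theta_2$ be two real numbers and define, for $i,j\in[0,1]$ and $t\in\{1,2\}$, $$\hat X_t(i)=\mathbb E[X(i)\mid\theta=\hat\theta_t],\qquad \hat\beta(i)=\frac{\hat X_1(i)-\hat X_2(i)}{\hat\theta_1-\hat\theta_2},\qquad \hat\gamma(i,j)=\mathrm{Cov}[X(i),X(j)\mid\theta=\hat\theta_1].$$ Suppose $\mathcal X$ is generated by a canonical information structure $(h,g)$ and an affine equilibrium $(\varphi_0^*,\varphi_1^* )$ of the LQG game formed by some payoff structure and $(h,g)$; that is, $\mathcal X$ is distributed as $$X(i)=\varphi_0^*(i)+\varphi_1^*(i)h(i)(\theta-\mu_\theta)+\varphi_1^*(i)\varepsilon(i),\quad i\in[0,1],$$ with $\{\varepsilon(i)\}_{i\in[0,1]}$ a centered Gaussian process with covariance $g$ independent of $\theta$. Then the following identification results hold (that is, every such $(h,g,\varphi_0^*,\varphi_1^* )$ satisfies the stated formulae, whose right-hand sides depend only on the conditional distributions of the actions given $\theta=\hat\theta_1$ and $\theta=\hat\theta_2$, on $\hat\theta_1,\hat\theta_2$ and on $\mu_\theta,\sigma_\theta$): (i) The equilibrium intercept is identified as $\varphi_0^*(i)=\hat X_1(i)-\hat\beta(i)(\hat\theta_1-\mu_\theta)$. (ii) If $\mathrm{Var}[X(i)]>0$ for every $i\in[0,1]$, then $h(i)$ and $g(i,i)$ are identified as $$h(i)=\frac{|\hat\beta(i)|}{\sqrt{\sigma_\theta^2\hat\beta(i)^2+\hat\gamma(i,i)}},\qquad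 g(i,i)=\frac{\hat\gamma(i,i)}{\sigma_\theta^2\hat\beta(i)^2+\hat\gamma(i,i)}.$$ Moreover, the absolute values of $\varphi_1^*(i)$ and of $g(i,j)$ for $i\neq j$ are identified, with formulae obtained by taking the absolute values of the corresponding expressions in part (iii). (iii) If $\mathbb E[X(i)\mid\theta=\hat\theta_1]\neq\mathbb E[X(i)\mid\theta=\hat\theta_2]$ for every $i\in[0,1]$, then $\varphi_1^*(i)$ and $g(i,j)$ for $i\neq j$ are identified as $$\varphi_1^*(i)=\mathrm{sgn}(\hat\beta(i))\sqrt{\sigma_\theta^2\hat\beta(i)^2+\hat\gamma(i,i)},\qquad g(i,j)=\frac{\mathrm{sgn}(\hat\beta(i)\hat\beta(j))\cdot\hat\gamma(i,j)}{\sqrt{(\sigma_\theta^2\hat\beta(i)^2+\hat\gamma(i,i))(\sigma_\theta^2\hat\beta(j)^2+\hat\gamma(j,j))}}.$$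
   Context: Fix $\mu_\theta\in\mathbb R$ and $\sigma_\theta>0$, both known; always $\theta\sim\mathcal N(\mu_\theta,\sigma_\theta^2)$. Agents are indexed by $[0,1]$ with Lebesgue measure. $\mathrm{sgn}(r)=1$ if $r>0$, $-1$ if $r<0$, $0$ if $r=0$. A Gaussian process is a collection of random variables all of whose finite subcollections are multivariate normal (possibly degenerate). Conditional moments given $\theta=\hat\theta$ are the usual Gaussian ones: $\mathbb E[X(i)\mid\theta=\hat\theta]=\mathbb E[X(i)]+\sigma_\theta^{-2}\mathrm{Cov}[X(i),\theta](\hat\theta-\mu_\theta)$ and $\mathrm{Cov}[X(i),X(j)\mid\theta=\hat\theta]=\mathrm{Cov}[X(i),X(j)]-\sigma_\theta^{-2}\mathrm{Cov}[X(i),\theta]\mathrm{Cov}[X(j),\theta]$. Conditional observability: an observer sees the conditional distributions of the action process $X(\cdot)$ given $\theta=\hat\theta_t$ for the two distinct, also observed, state realizations $\hat\theta_1,\hat\theta_2$. Payoff structure: $(w,b,c)$ with $w:[0,1]^2\to\mathbb R$ and $b,c:[0,1]\to\mathbb R$ square-integrable ($\int_0^1\int_0^1|w|^2<\infty$, $\int_0^1|b|^2<\infty$, $\int_0^1|c|^2<\infty$), otherwise unrestricted. Gaussian BCE under $(w,b,c)$: a Gaussian process $\mathcal X=\{\theta\}\cup\{X(i)\}_{i\in[0,1]}$ such that for every $i$, $\mathbb E[X(i)]=\int_0^1 w(i,j)\mathbb E[X(j)]\,dj+b(i)\mu_\theta+c(i)$ and $\mathrm{Var}[X(i)]=\int_0^1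 w(i,j)\mathrm{Cov}[X(i),X(j)]\,dj+b(i)\mathrm{Cov}[X(i),\theta]$. Canonical information structure $(h,g)$: each agent $i$ receives a one-dimensional signal $S^*(i)=h(i)\theta+\varepsilon(i)$ with $\mathrm{Var}[S^*(i)]=1$, where $h:[0,1]\to[0,\infty)$, $g:[0,1]^2\to\mathbb R$, and $\{\theta\}\cup\{\varepsilon(i)\}_{i\in[0,1]}$ is a Gaussian process with $\mathbb E[\varepsilon(i)]=0$, $\mathrm{Cov}[\varepsilon(i),\theta]=0$, $\mathrm{Cov}[\varepsilon(i),\varepsilon(j)]=g(i,j)$. Put $P(i,j)=\sigma_\theta^2h(i)h(j)+g(i,j)$ and $P_\theta(i)=\sigma_\theta h(i)$, assumed measurable as functions of the agent index $i\in[0,1]$. An affine equilibrium of the LQG game $(w,b,c,(h,g))$ is a pair $(\varphi_0^*,\varphi_1^* )$ of functions in $L_2[0,1]$ such that for every $i$: $\varphi_0^*(i)=\int_0^1 w(i,j)\varphi_0^*(j)\,dj+\mu_\theta b(i)+c(i)$ and $\varphi_1^*(i)=\int_0^1 w(i,j)P(i,j)\varphi_1^*(j)\,dj+\sigma_\theta b(i)P_\theta(i)$. The strategies are $X(i)=\varphi_0^*(i)+\varphi_1^*(i)(S^*(i)-\mathbb E[S^*(i)])$, which with $\theta$ form the induced outcome.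
   Formalization: In the "Moreover" of (ii) the sign factors are dropped, so |φ₁*(i)| = √(σ_θ²β̂(i)²+γ̂(i,i)) and |g(i,j)| uses |γ̂(i,j)|; with sgn(0)=0 the literal absolute values of (iii) are false where β̂=0 (e.g. h=0, g=w=1, b=c=0, φ₁*=1). *)

theory Defs
  imports "HOL-Probability.Probability"
begin

definition covariance :: "'a measure \<Rightarrow> ('a \<Rightarrow> real) \<Rightarrow> ('a \<Rightarrow> real) \<Rightarrow> real" where
  "covariance M Y Z =
     integral\<^sup>L M (\<lambda>\<omega>. (Y \<omega> - integral\<^sup>L M Y) * (Z \<omega> - integral\<^sup>L M Z))"

definition univariate_normal :: "'a measure \<Rightarrow> ('a \<Rightarrow> real) \<Rightarrow> bool" where
  "univariate_normal M Y \<longleftrightarrow>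
     Y \<in> borel_measurable M \<and>
     ((\<exists>m s. s > 0 \<and> distributed M lborel Y (normal_density m s)) \<or> (\<exists>m. AE \<omega> in M. Y \<omega> = m))"

text \<open>A finite family is (possibly degenerately) multivariate normal if all its linear
  combinations are (possibly degenerately) normal.\<close>

definition multivariate_normal :: "'a measure \<Rightarrow> 't set \<Rightarrow> ('t \<Rightarrow> 'a \<Rightarrow> real) \<Rightarrow> bool" where
  "multivariate_normal M F Y \<longleftrightarrow>
     (\<forall>t\<in>F. Y t \<in> borel_measurable M) \<and>
     (\<forall>a :: 't \<Rightarrow> real. univariate_normal M (\<lambda>\<omega>. \<Sum>t\<in>F. a t * Y t \<omega>))"

definition gaussian_process :: "'a measure \<Rightarrow> 't set \<Rightarrow> ('t \<Rightarrow> 'a \<Rightarrow> real) \<Rightarrow> bool" where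
  "gaussian_process M T Y \<longleftrightarrow>
     prob_space M \<and> (\<forall>F. finite F \<and> F \<subseteq> T \<longrightarrow> multivariate_normal M F Y)"

text \<open>Equality in law: the finite-dimensional distributions agree. The two processes may live on
  different probability spaces.\<close>

definition same_law ::
  "'t set \<Rightarrow> 'a measure \<Rightarrow> ('t \<Rightarrow> 'a \<Rightarrow> real) \<Rightarrow> 'b measure \<Rightarrow> ('t \<Rightarrow> 'b \<Rightarrow> real) \<Rightarrow> bool" where
  "same_law T M Y N Z \<longleftrightarrow>
     (\<forall>F. finite F \<and> F \<subseteq> T \<longrightarrow>
        distr M (Pi\<^sub>M F (\<lambda>_. borel)) (\<lambda>\<omega>. \<lambda>t\<in>F. Y t \<omega>) =
        distr N (Pi\<^sub>M F (\<lambda>_. borel)) (\<lambda>\<omega>. \<lambda>t\<in>F. Z t \<omega>))"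

text \<open>The agents are the points of \<open>[0,1]\<close>. The joint process of the state and an agent-indexed
  family carries the state at index \<^term>\<open>None\<close> and agent \<open>i\<close> at index \<^term>\<open>Some i\<close>.\<close>

abbreviation agents :: "real set" where
  "agents \<equiv> {0..1}"

definition with_state :: "('a \<Rightarrow> real) \<Rightarrow> (real \<Rightarrow> 'a \<Rightarrow> real) \<Rightarrow> real option \<Rightarrow> 'a \<Rightarrow> real" where
  "with_state \<theta> X = (\<lambda>t. case t of None \<Rightarrow> \<theta> | Some i \<Rightarrow> X i)"

definition state_agents :: "real option set" where
  "state_agents = insert None (Some ` agents)"

definition normal_state :: "'a measure \<Rightarrow> ('a \<Rightarrow> real) \<Rightarrow> real \<Rightarrow> real \<Rightarrow> bool" where
  "normal_state M \<theta> \<mu> \<sigma> \<longleftrightarrow> distributed M lborel \<theta> (normal_density \<mu> \<sigma>)"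

text \<open>Conditional moments given the event that the state equals \<open>t\<close>. This event is null, so they are
  given by the Gaussian regression formulas, for a state of mean \<open>\<mu>\<close> and standard deviation
  \<open>\<sigma>\<close>.\<close>

definition cond_mean ::
  "'a measure \<Rightarrow> ('a \<Rightarrow> real) \<Rightarrow> real \<Rightarrow> real \<Rightarrow> ('a \<Rightarrow> real) \<Rightarrow> real \<Rightarrow> real" where
  "cond_mean M \<theta> \<mu> \<sigma> Y t = integral\<^sup>L M Y + covariance M Y \<theta> / \<sigma>\<^sup>2 * (t - \<mu>)"

text \<open>For jointly normal variables the conditional covariance is the same at every state
  realization \<open>t\<close>.\<close>

definition cond_cov ::
  "'a measure \<Rightarrow> ('a \<Rightarrow> real) \<Rightarrow> real \<Rightarrow> ('a \<Rightarrow> real) \<Rightarrow> ('a \<Rightarrow> real) \<Rightarrow> real \<Rightarrow> real" where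
  "cond_cov M \<theta> \<sigma> Y Z t =
     covariance M Y Z - covariance M Y \<theta> * covariance M Z \<theta> / \<sigma>\<^sup>2"

definition square_integrable_on ::
  "('c::euclidean_space \<Rightarrow> real) \<Rightarrow> 'c set \<Rightarrow> bool" where
  "square_integrable_on f S \<longleftrightarrow>
     f \<in> borel_measurable (lebesgue_on S) \<and> integrable (lebesgue_on S) (\<lambda>x. (f x)\<^sup>2)"

definition payoff_structure ::
  "(real \<Rightarrow> real \<Rightarrow> real) \<Rightarrow> (real \<Rightarrow> real) \<Rightarrow> (real \<Rightarrow> real) \<Rightarrow> bool" where
  "payoff_structure w b c \<longleftrightarrow>
     square_integrable_on (\<lambda>(i, j). w i j) (agents \<times> agents) \<and>
     square_integrable_on b agents \<and> square_integrable_on c agents"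

text \<open>The Bochner integral of a non-integrable function is zero in the library, so the existence of
  each integral over agents is demanded separately, here and below.\<close>

definition gaussian_BCE ::
  "real \<Rightarrow> real \<Rightarrow> (real \<Rightarrow> real \<Rightarrow> real) \<Rightarrow> (real \<Rightarrow> real) \<Rightarrow> (real \<Rightarrow> real) \<Rightarrow>
   'a measure \<Rightarrow> ('a \<Rightarrow> real) \<Rightarrow> (real \<Rightarrow> 'a \<Rightarrow> real) \<Rightarrow> bool" where
  "gaussian_BCE \<mu> \<sigma> w b c M \<theta> X \<longleftrightarrow>
     gaussian_process M state_agents (with_state \<theta> X) \<and>
     normal_state M \<theta> \<mu> \<sigma> \<and>
     (\<forall>i\<in>agents.
        integrable (lebesgue_on agents) (\<lambda>j. w i j * integral\<^sup>L M (X j)) \<and>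
        integral\<^sup>L M (X i) =
          (LINT j|lebesgue_on agents. w i j * integral\<^sup>L M (X j)) + b i * \<mu> + c i) \<and>
     (\<forall>i\<in>agents.
        integrable (lebesgue_on agents) (\<lambda>j. w i j * covariance M (X i) (X j)) \<and>
        prob_space.variance M (X i) =
          (LINT j|lebesgue_on agents. w i j * covariance M (X i) (X j))
          + b i * covariance M (X i) \<theta>)"

definition signal ::
  "(real \<Rightarrow> real) \<Rightarrow> ('a \<Rightarrow> real) \<Rightarrow> (real \<Rightarrow> 'a \<Rightarrow> real) \<Rightarrow> real \<Rightarrow> 'a \<Rightarrow> real" where
  "signal h \<theta> \<epsilon> i \<omega> = h i * \<theta> \<omega> + \<epsilon> i \<omega>"

text \<open>Signals have unit variance, so these are the correlations between two signals and between a
  signal and the state.\<close>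

definition signal_corr ::
  "real \<Rightarrow> (real \<Rightarrow> real) \<Rightarrow> (real \<Rightarrow> real \<Rightarrow> real) \<Rightarrow> real \<Rightarrow> real \<Rightarrow> real" where
  "signal_corr \<sigma> h g i j = \<sigma>\<^sup>2 * h i * h j + g i j"

definition state_corr :: "real \<Rightarrow> (real \<Rightarrow> real) \<Rightarrow> real \<Rightarrow> real" where
  "state_corr \<sigma> h i = \<sigma> * h i"

text \<open>The pair \<open>(h, g)\<close> is a canonical information structure, realized by the state \<open>\<theta>\<close> and the
  noise terms \<open>\<epsilon>\<close> on \<open>N\<close>. Since the joint process is Gaussian, the vanishing covariances say that
  \<open>\<epsilon>\<close> is independent of \<open>\<theta>\<close>.\<close>

definition canonical_information ::
  "real \<Rightarrow> real \<Rightarrow> (real \<Rightarrow> real) \<Rightarrow> (real \<Rightarrow> real \<Rightarrow> real) \<Rightarrow>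
   'b measure \<Rightarrow> ('b \<Rightarrow> real) \<Rightarrow> (real \<Rightarrow> 'b \<Rightarrow> real) \<Rightarrow> bool" where
  "canonical_information \<mu> \<sigma> h g N \<theta> \<epsilon> \<longleftrightarrow>
     gaussian_process N state_agents (with_state \<theta> \<epsilon>) \<and>
     normal_state N \<theta> \<mu> \<sigma> \<and>
     (\<forall>i\<in>agents. h i \<ge> 0) \<and>
     (\<forall>i\<in>agents. integral\<^sup>L N (\<epsilon> i) = 0) \<and>
     (\<forall>i\<in>agents. covariance N (\<epsilon> i) \<theta> = 0) \<and>
     (\<forall>i\<in>agents. \<forall>j\<in>agents. covariance N (\<epsilon> i) (\<epsilon> j) = g i j) \<and>
     (\<forall>i\<in>agents. prob_space.variance N (signal h \<theta> \<epsilon> i) = 1) \<and>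
     (\<forall>j\<in>agents. (\<lambda>i. signal_corr \<sigma> h g i j) \<in> borel_measurable (lebesgue_on agents)) \<and>
     state_corr \<sigma> h \<in> borel_measurable (lebesgue_on agents)"

definition affine_equilibrium ::
  "real \<Rightarrow> real \<Rightarrow> (real \<Rightarrow> real \<Rightarrow> real) \<Rightarrow> (real \<Rightarrow> real) \<Rightarrow> (real \<Rightarrow> real) \<Rightarrow>
   (real \<Rightarrow> real) \<Rightarrow> (real \<Rightarrow> real \<Rightarrow> real) \<Rightarrow> (real \<Rightarrow> real) \<Rightarrow> (real \<Rightarrow> real) \<Rightarrow> bool" where
  "affine_equilibrium \<mu> \<sigma> w b c h g \<phi>0 \<phi>1 \<longleftrightarrow>
     square_integrable_on \<phi>0 agents \<and> square_integrable_on \<phi>1 agents \<and>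
     (\<forall>i\<in>agents.
        integrable (lebesgue_on agents) (\<lambda>j. w i j * \<phi>0 j) \<and>
        \<phi>0 i = (LINT j|lebesgue_on agents. w i j * \<phi>0 j) + \<mu> * b i + c i) \<and>
     (\<forall>i\<in>agents.
        integrable (lebesgue_on agents) (\<lambda>j. w i j * signal_corr \<sigma> h g i j * \<phi>1 j) \<and>
        \<phi>1 i = (LINT j|lebesgue_on agents. w i j * signal_corr \<sigma> h g i j * \<phi>1 j)
               + \<sigma> * b i * state_corr \<sigma> h i)"

text \<open>This is \<open>\<phi>0 i + \<phi>1 i * (S i - E[S i])\<close> for the signal \<open>S = signal h \<theta> \<epsilon>\<close> with centered noise.\<close>

definition affine_outcome ::
  "real \<Rightarrow> (real \<Rightarrow> real) \<Rightarrow> (real \<Rightarrow> real) \<Rightarrow> (real \<Rightarrow> real) \<Rightarrow>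
   ('b \<Rightarrow> real) \<Rightarrow> (real \<Rightarrow> 'b \<Rightarrow> real) \<Rightarrow> real \<Rightarrow> 'b \<Rightarrow> real" where
  "affine_outcome \<mu> h \<phi>0 \<phi>1 \<theta> \<epsilon> i \<omega> = \<phi>0 i + \<phi>1 i * h i * (\<theta> \<omega> - \<mu>) + \<phi>1 i * \<epsilon> i \<omega>"

end

theory Submission
  imports Defs
begin

text \<open>Equality in law transports means and covariances from the observed process to the affine
  outcome. There the normalisation \<open>\<sigma>\<^sup>2 * (h i)\<^sup>2 + g i i = 1\<close> of the signal variance turns
  \<open>\<beta> i = \<phi>1 i * h i\<close> and \<open>\<gamma> i j = \<phi>1 i * \<phi>1 j * g i j\<close> into
  \<open>\<sigma>\<^sup>2 * (\<beta> i)\<^sup>2 + \<gamma> i i = (\<phi>1 i)\<^sup>2\<close>, and \<open>h \<ge> 0\<close> makes the sign of \<open>\<beta> i\<close>, when nonzero,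
  that of \<open>\<phi>1 i\<close>.\<close>

section \<open>Measurability and finite second moments of Gaussian processes\<close>

lemma gaussian_process_borel_measurable:
  assumes "gaussian_process M T Y" and "t \<in> T"
  shows "Y t \<in> borel_measurable M"
proof -
  have "multivariate_normal M {t} Y"
    using assms by (simp add: gaussian_process_def)
  then show ?thesis
    by (simp add: multivariate_normal_def)
qed

text \<open>A nondegenerate normal law has moments of every order, so the square is integrable
  against its density; a degenerate one is almost surely constant on a finite measure. Finite second
  moments are what makes all covariances below genuine integrals.\<close>

lemma univariate_normal_integrable_power2:
  assumes "prob_space M" and "univariate_normal M Y"
  shows "integrable M (\<lambda>\<omega>. (Y \<omega>)\<^sup>2)"
proof -
  interpret prob_space M by fact
  have Y[measurable]: "Y \<in> borel_measurable M"
    using assms by (simp add: univariate_normal_def)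
  consider m s where "s > 0" "distributed M lborel Y (normal_density m s)"
    | m where "AE \<omega> in M. Y \<omega> = m"
    using assms by (auto simp: univariate_normal_def)
  then show ?thesis
  proof cases
    case 1
    \<comment> \<open>Writing \<open>x^2 = (x - m)^2 + 2 * m * x - m^2\<close> splits the second
      moment into the central second moment, the first moment and the total mass, each known to be
      integrable.\<close>
    have eq: "normal_density m s x * x\<^sup>2 = normal_density m s x * (x - m)^2
        + 2 * m * (normal_density m s x * x) - m\<^sup>2 * normal_density m s x" for x
      by (simp add: power2_eq_square algebra_simps)
    have "integrable lborel (\<lambda>x. normal_density m s x * x\<^sup>2)"
      unfolding eq using \<open>s > 0\<close>
      by (intro Bochner_Integration.integrable_add Bochner_Integration.integrable_diff
          integrable_mult_right integrable_normal_moment integrable_normal_moment_nz_1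
          integrable_normal_density)
    then show ?thesis
      using distributed_integrable[OF 1(2), of "\<lambda>x. x\<^sup>2"] by simp
  next
    case 2
    have "integrable M (\<lambda>\<omega>. (Y \<omega>)\<^sup>2) \<longleftrightarrow> integrable M (\<lambda>\<omega>. m\<^sup>2)"
      using 2 by (intro integrable_cong_AE) auto
    then show ?thesis
      by simp
  qed
qed

lemma gaussian_process_integrable_power2:
  assumes "gaussian_process M T Y" and "t \<in> T"
  shows "integrable M (\<lambda>\<omega>. (Y t \<omega>)\<^sup>2)"
proof -
  have "multivariate_normal M {t} Y"
    using assms by (simp add: gaussian_process_def)
  \<comment> \<open>The linear combination over a singleton with coefficient 1 is the variable
    itself.\<close>
  then have "univariate_normal M (\<lambda>\<omega>. \<Sum>u\<in>{t}. 1 * Y u \<omega>)"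
    unfolding multivariate_normal_def by (elim conjE) (drule spec[of _ "\<lambda>_. 1"])
  then have "univariate_normal M (Y t)"
    by simp
  then show ?thesis
    using assms by (intro univariate_normal_integrable_power2) (auto simp: gaussian_process_def)
qed

section \<open>Covariance calculus for square-integrable variables\<close>

lemma integrable_mult_square_integrable:
  fixes Y Z :: "'a \<Rightarrow> real"
  assumes [measurable]: "Y \<in> borel_measurable M" "Z \<in> borel_measurable M"
    and "integrable M (\<lambda>\<omega>. (Y \<omega>)\<^sup>2)" "integrable M (\<lambda>\<omega>. (Z \<omega>)\<^sup>2)"
  shows "integrable M (\<lambda>\<omega>. Y \<omega> * Z \<omega>)"
proof (rule Bochner_Integration.integrable_bound)
  show "integrable M (\<lambda>\<omega>. (Y \<omega>)\<^sup>2 + (Z \<omega>)\<^sup>2)"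
    using assms by simp
  have "\<bar>y * z\<bar> \<le> y\<^sup>2 + z\<^sup>2" for y z :: real
  proof -
    have "2 * \<bar>y * z\<bar> \<le> y\<^sup>2 + z\<^sup>2"
      using sum_squares_bound[of "\<bar>y\<bar>" "\<bar>z\<bar>"] by (simp add: abs_mult)
    then show ?thesis by linarith
  qed
  then show "AE \<omega> in M. norm (Y \<omega> * Z \<omega>) \<le> norm ((Y \<omega>)\<^sup>2 + (Z \<omega>)\<^sup>2)"
    by simp
qed measurable

lemma (in prob_space) integrable_centered_mult:
  fixes Y Z :: "'a \<Rightarrow> real"
  assumes [measurable]: "Y \<in> borel_measurable M" "Z \<in> borel_measurable M"
    and sq: "integrable M (\<lambda>\<omega>. (Y \<omega>)\<^sup>2)" "integrable M (\<lambda>\<omega>. (Z \<omega>)\<^sup>2)"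
  shows "integrable M (\<lambda>\<omega>. (Y \<omega> - m) * (Z \<omega> - n))"
proof -
  have "integrable M Y" "integrable M Z"
    using sq by (auto intro: square_integrable_imp_integrable)
  moreover have "integrable M (\<lambda>\<omega>. Y \<omega> * Z \<omega>)"
    using sq by (intro integrable_mult_square_integrable) auto
  ultimately show ?thesis
    by (simp add: algebra_simps)
qed

text \<open>Signals and affine outcomes both combine the common state \<open>T\<close> with an
  individual noise term \<open>U\<close> or \<open>V\<close>. Intercepts drop out on centering and
  the rest is bilinearity; this one expansion yields every covariance used later.\<close>

lemma (in prob_space) covariance_affine:
  fixes T U V :: "'a \<Rightarrow> real"
  assumes meas: "T \<in> borel_measurable M" "U \<in> borel_measurable M" "V \<in> borel_measurable M"
    and sq: "integrable M (\<lambda>\<omega>. (T \<omega>)\<^sup>2)" "integrable M (\<lambda>\<omega>. (U \<omega>)\<^sup>2)"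
      "integrable M (\<lambda>\<omega>. (V \<omega>)\<^sup>2)"
  shows "covariance M (\<lambda>\<omega>. a + b * T \<omega> + c * U \<omega>) (\<lambda>\<omega>. a' + b' * T \<omega> + c' * V \<omega>) =
    b * b' * covariance M T T + b * c' * covariance M T V
    + c * b' * covariance M U T + c * c' * covariance M U V"
proof -
  have int: "integrable M T" "integrable M U" "integrable M V"
    using meas sq by (auto intro: square_integrable_imp_integrable)
  define T0 where "T0 \<omega> = T \<omega> - expectation T" for \<omega>
  define U0 where "U0 \<omega> = U \<omega> - expectation U" for \<omega>
  define V0 where "V0 \<omega> = V \<omega> - expectation V" for \<omega>
  have prods: "integrable M (\<lambda>\<omega>. T0 \<omega> * T0 \<omega>)" "integrable M (\<lambda>\<omega>. T0 \<omega> * V0 \<omega>)"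
    "integrable M (\<lambda>\<omega>. U0 \<omega> * T0 \<omega>)" "integrable M (\<lambda>\<omega>. U0 \<omega> * V0 \<omega>)"
    unfolding T0_def U0_def V0_def using meas sq by (auto intro!: integrable_centered_mult)
  \<comment> \<open>With these means, the centered arguments are \<open>b * T0 + c * U0\<close> and
    \<open>b' * T0 + c' * V0\<close>.\<close>
  have mean: "expectation (\<lambda>\<omega>. a + b * T \<omega> + c * U \<omega>) = a + b * expectation T + c * expectation U"
    "expectation (\<lambda>\<omega>. a' + b' * T \<omega> + c' * V \<omega>) = a' + b' * expectation T + c' * expectation V"
    using int by (simp_all add: prob_space)
  have "covariance M (\<lambda>\<omega>. a + b * T \<omega> + c * U \<omega>) (\<lambda>\<omega>. a' + b' * T \<omega> + c' * V \<omega>) =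
    expectation (\<lambda>\<omega>. (b * T0 \<omega> + c * U0 \<omega>) * (b' * T0 \<omega> + c' * V0 \<omega>))"
    unfolding covariance_def mean T0_def U0_def V0_def
    by (intro Bochner_Integration.integral_cong refl) (simp add: algebra_simps)
  also have "\<dots> = expectation (\<lambda>\<omega>. b * b' * (T0 \<omega> * T0 \<omega>) + b * c' * (T0 \<omega> * V0 \<omega>)
      + c * b' * (U0 \<omega> * T0 \<omega>) + c * c' * (U0 \<omega> * V0 \<omega>))"
    by (intro Bochner_Integration.integral_cong refl) (simp add: algebra_simps)
  also have "\<dots> = b * b' * expectation (\<lambda>\<omega>. T0 \<omega> * T0 \<omega>) + b * c' * expectation (\<lambda>\<omega>. T0 \<omega> * V0 \<omega>)
      + c * b' * expectation (\<lambda>\<omega>. U0 \<omega> * T0 \<omega>) + c * c' * expectation (\<lambda>\<omega>. U0 \<omega> * V0 \<omega>)"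
    using prods by simp
  finally show ?thesis
    by (simp add: covariance_def T0_def U0_def V0_def)
qed

lemma covariance_commute: "covariance M Y Z = covariance M Z Y"
  by (simp add: covariance_def mult.commute)

lemma variance_eq_covariance: "prob_space.variance M Y = covariance M Y Y"
  by (simp add: covariance_def power2_eq_square)

section \<open>Transfer of moments along equality in law\<close>

text \<open>Both sides are the integral of \<open>f\<close> against the same finite-dimensional
  distribution, by change of variables on each space.\<close>

lemma same_law_integral:
  fixes f :: "('t \<Rightarrow> real) \<Rightarrow> real"
  assumes "same_law T M Y N Z" and F: "finite F" "F \<subseteq> T"
    and "\<And>t. t \<in> F \<Longrightarrow> Y t \<in> borel_measurable M" "\<And>t. t \<in> F \<Longrightarrow> Z t \<in> borel_measurable N"
    and f: "f \<in> borel_measurable (Pi\<^sub>M F (\<lambda>_. borel))"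
  shows "(\<integral>\<omega>. f (\<lambda>t\<in>F. Y t \<omega>) \<partial>M) = (\<integral>\<omega>. f (\<lambda>t\<in>F. Z t \<omega>) \<partial>N)"
proof -
  have Y: "(\<lambda>\<omega>. \<lambda>t\<in>F. Y t \<omega>) \<in> measurable M (Pi\<^sub>M F (\<lambda>_. borel))"
    and Z: "(\<lambda>\<omega>. \<lambda>t\<in>F. Z t \<omega>) \<in> measurable N (Pi\<^sub>M F (\<lambda>_. borel))"
    using assms by (auto intro!: measurable_restrict)
  have "distr M (Pi\<^sub>M F (\<lambda>_. borel)) (\<lambda>\<omega>. \<lambda>t\<in>F. Y t \<omega>) =
      distr N (Pi\<^sub>M F (\<lambda>_. borel)) (\<lambda>\<omega>. \<lambda>t\<in>F. Z t \<omega>)"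
    using assms by (simp add: same_law_def)
  then show ?thesis
    using integral_distr[OF Y f] integral_distr[OF Z f] by simp
qed

lemma same_law_expectation:
  assumes "same_law T M Y N Z" and "s \<in> T"
    and "\<And>t. t \<in> T \<Longrightarrow> Y t \<in> borel_measurable M" "\<And>t. t \<in> T \<Longrightarrow> Z t \<in> borel_measurable N"
  shows "integral\<^sup>L M (Y s) = integral\<^sup>L N (Z s)"
  using same_law_integral[OF assms(1), of "{s}" "\<lambda>y. y s"] assms by simp

lemma same_law_covariance:
  assumes "same_law T M Y N Z" and "s \<in> T" "t \<in> T"
    and "\<And>t. t \<in> T \<Longrightarrow> Y t \<in> borel_measurable M" "\<And>t. t \<in> T \<Longrightarrow> Z t \<in> borel_measurable N"
  shows "covariance M (Y s) (Y t) = covariance N (Z s) (Z t)"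
proof -
  have mean: "integral\<^sup>L M (Y u) = integral\<^sup>L N (Z u)" if "u \<in> T" for u
    using assms that by (intro same_law_expectation)
  \<comment> \<open>Since the means agree, one test function centered at the means on
    \<open>N\<close> serves both sides. The case \<open>s = t\<close> is included, with
    \<open>{s, t}\<close> a singleton.\<close>
  let ?f = "\<lambda>y. (y s - integral\<^sup>L N (Z s)) * (y t - integral\<^sup>L N (Z t))"
  have "?f \<in> borel_measurable (Pi\<^sub>M {s, t} (\<lambda>_. borel))"
    by measurable
  then show ?thesis
    using same_law_integral[OF assms(1), of "{s, t}" ?f] assms(2-)
    by (auto simp: covariance_def mean)
qed

section \<open>Moments of the state, the noise and the signals\<close>

lemma canonical_information_noise:
  assumes "canonical_information \<mu> \<sigma> h g N \<theta> \<epsilon>" and "i \<in> agents"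
  shows "\<epsilon> i \<in> borel_measurable N" and "integrable N (\<lambda>\<omega>. (\<epsilon> i \<omega>)\<^sup>2)"
proof -
  have G: "gaussian_process N state_agents (with_state \<theta> \<epsilon>)"
    using assms by (simp add: canonical_information_def)
  have mem: "Some i \<in> state_agents"
    using assms by (simp add: state_agents_def)
  show "\<epsilon> i \<in> borel_measurable N" "integrable N (\<lambda>\<omega>. (\<epsilon> i \<omega>)\<^sup>2)"
    using gaussian_process_borel_measurable[OF G mem]
      gaussian_process_integrable_power2[OF G mem] by (simp_all add: with_state_def)
qed

lemma canonical_information_state:
  assumes "canonical_information \<mu> \<sigma> h g N \<theta> \<epsilon>" and "\<sigma> > 0"
  shows "\<theta> \<in> borel_measurable N" and "integrable N (\<lambda>\<omega>. (\<theta> \<omega>)\<^sup>2)"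
    and "integral\<^sup>L N \<theta> = \<mu>" and "covariance N \<theta> \<theta> = \<sigma>\<^sup>2"
proof -
  have G: "gaussian_process N state_agents (with_state \<theta> \<epsilon>)"
    and D: "distributed N lborel \<theta> (normal_density \<mu> \<sigma>)"
    using assms by (simp_all add: canonical_information_def normal_state_def)
  interpret prob_space N
    using G by (simp add: gaussian_process_def)
  have mem: "None \<in> state_agents"
    by (simp add: state_agents_def)
  show "\<theta> \<in> borel_measurable N" "integrable N (\<lambda>\<omega>. (\<theta> \<omega>)\<^sup>2)"
    using gaussian_process_borel_measurable[OF G mem]
      gaussian_process_integrable_power2[OF G mem] by (simp_all add: with_state_def)
  show "integral\<^sup>L N \<theta> = \<mu>"
    using normal_distributed_expectation[OF \<open>\<sigma> > 0\<close> D] .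
  show "covariance N \<theta> \<theta> = \<sigma>\<^sup>2"
    using normal_distributed_variance[OF \<open>\<sigma> > 0\<close> D] by (simp add: covariance_def power2_eq_square)
qed

text \<open>The noise is uncorrelated with the state, so the normalized signal variance splits into
  a state part and a noise part. This normalization fixes the scale that would otherwise be shared
  freely between \<open>\<phi>1\<close> and the signal.\<close>

lemma canonical_information_unit_variance:
  assumes can: "canonical_information \<mu> \<sigma> h g N \<theta> \<epsilon>" and "\<sigma> > 0" and i: "i \<in> agents"
  shows "\<sigma>\<^sup>2 * (h i)\<^sup>2 + g i i = 1"
proof -
  interpret prob_space N
    using can by (simp add: canonical_information_def gaussian_process_def)
  note [simp] = canonical_information_state[OF can \<open>\<sigma> > 0\<close>] canonical_information_noise[OF can i]
  have "covariance N (\<epsilon> i) \<theta> = 0" "covariance N \<theta> (\<epsilon> i) = 0" "covariance N (\<epsilon> i) (\<epsilon> i) = g i i"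
    using can i covariance_commute[of N \<theta>] by (simp_all add: canonical_information_def)
  note [simp] = this
  \<comment> \<open>The explicit 0 and 1 give the signal the syntactic shape of
    \<open>covariance_affine\<close>.\<close>
  have signal: "signal h \<theta> \<epsilon> i = (\<lambda>\<omega>. 0 + h i * \<theta> \<omega> + 1 * \<epsilon> i \<omega>)"
    by (simp add: fun_eq_iff signal_def)
  have "1 = covariance N (signal h \<theta> \<epsilon> i) (signal h \<theta> \<epsilon> i)"
    using can i variance_eq_covariance[of N "signal h \<theta> \<epsilon> i"]
    by (simp add: canonical_information_def)
  also have "\<dots> = \<sigma>\<^sup>2 * (h i)\<^sup>2 + g i i"
    unfolding signal by (subst covariance_affine) (simp_all add: power2_eq_square[of "h i"])
  finally show ?thesis by simp
qed

section \<open>Moments of the affine outcome\<close>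

lemma affine_outcome_eq:
  "affine_outcome \<mu> h \<phi>0 \<phi>1 \<theta> \<epsilon> i =
    (\<lambda>\<omega>. (\<phi>0 i - \<phi>1 i * h i * \<mu>) + \<phi>1 i * h i * \<theta> \<omega> + \<phi>1 i * \<epsilon> i \<omega>)"
  by (simp add: fun_eq_iff affine_outcome_def algebra_simps)

lemma affine_outcome_moments:
  fixes \<phi>0 \<phi>1 :: "real \<Rightarrow> real"
  assumes can: "canonical_information \<mu> \<sigma> h g N \<theta> \<epsilon>" and "\<sigma> > 0"
    and i: "i \<in> agents" and j: "j \<in> agents"
  defines "A \<equiv> affine_outcome \<mu> h \<phi>0 \<phi>1 \<theta> \<epsilon>"
  shows "A i \<in> borel_measurable N"
    and "integral\<^sup>L N (A i) = \<phi>0 i"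
    and "covariance N (A i) \<theta> = \<phi>1 i * h i * \<sigma>\<^sup>2"
    and "covariance N (A i) (A j) = \<phi>1 i * \<phi>1 j * (\<sigma>\<^sup>2 * h i * h j + g i j)"
proof -
  interpret prob_space N
    using can by (simp add: canonical_information_def gaussian_process_def)
  note [simp] = canonical_information_state[OF can \<open>\<sigma> > 0\<close>]
    canonical_information_noise[OF can i] canonical_information_noise[OF can j]
  have [simp]: "expectation (\<epsilon> i) = 0" "covariance N (\<epsilon> i) (\<epsilon> j) = g i j"
    "covariance N (\<epsilon> i) \<theta> = 0" "covariance N \<theta> (\<epsilon> i) = 0" "covariance N \<theta> (\<epsilon> j) = 0"
    using can i j covariance_commute[of N \<theta>] by (simp_all add: canonical_information_def)
  have [simp]: "integrable N \<theta>" "integrable N (\<epsilon> i)"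
    by (auto intro: square_integrable_imp_integrable)
  show "A i \<in> borel_measurable N"
    unfolding A_def affine_outcome_eq by (intro borel_measurable_add borel_measurable_times) simp_all
  show "integral\<^sup>L N (A i) = \<phi>0 i"
    by (simp add: A_def affine_outcome_eq prob_space)
  show "covariance N (A i) \<theta> = \<phi>1 i * h i * \<sigma>\<^sup>2"
    \<comment> \<open>The coefficients 0, 1, 0 make the second argument the state itself.\<close>
    using covariance_affine[of \<theta> "\<epsilon> i" \<theta> "\<phi>0 i - \<phi>1 i * h i * \<mu>" "\<phi>1 i * h i" "\<phi>1 i" 0 1 0]
    by (simp add: A_def affine_outcome_eq)
  show "covariance N (A i) (A j) = \<phi>1 i * \<phi>1 j * (\<sigma>\<^sup>2 * h i * h j + g i j)"
    unfolding A_def affine_outcome_eq by (subst covariance_affine) (simp_all add: algebra_simps)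
qed

section \<open>Identification from the conditional moments\<close>

theorem theorem3:
  fixes \<mu> \<sigma> t1 t2 :: real
    and M :: "'a measure" and \<theta> :: "'a \<Rightarrow> real" and X :: "real \<Rightarrow> 'a \<Rightarrow> real"
    and w w' :: "real \<Rightarrow> real \<Rightarrow> real" and b b' c c' :: "real \<Rightarrow> real"
    and N :: "'b measure" and \<theta>' :: "'b \<Rightarrow> real" and \<epsilon> :: "real \<Rightarrow> 'b \<Rightarrow> real"
    and h :: "real \<Rightarrow> real" and g :: "real \<Rightarrow> real \<Rightarrow> real" and \<phi>0 \<phi>1 :: "real \<Rightarrow> real"
    and Xhat1 Xhat2 \<beta> :: "real \<Rightarrow> real" and \<gamma> :: "real \<Rightarrow> real \<Rightarrow> real"
  assumes "\<sigma> > 0"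
    and "payoff_structure w b c"
    and "gaussian_BCE \<mu> \<sigma> w b c M \<theta> X"
    and "t1 \<noteq> t2"
    and "payoff_structure w' b' c'"
    and "canonical_information \<mu> \<sigma> h g N \<theta>' \<epsilon>"
    and "affine_equilibrium \<mu> \<sigma> w' b' c' h g \<phi>0 \<phi>1"
    and "same_law state_agents M (with_state \<theta> X)
           N (with_state \<theta>' (affine_outcome \<mu> h \<phi>0 \<phi>1 \<theta>' \<epsilon>))"
  defines "Xhat1 \<equiv> \<lambda>i. cond_mean M \<theta> \<mu> \<sigma> (X i) t1"
    and "Xhat2 \<equiv> \<lambda>i. cond_mean M \<theta> \<mu> \<sigma> (X i) t2"
    and "\<beta> \<equiv> \<lambda>i. (Xhat1 i - Xhat2 i) / (t1 - t2)"
    and "\<gamma> \<equiv> \<lambda>i j. cond_cov M \<theta> \<sigma> (X i) (X j) t1"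
  shows "(\<forall>i\<in>agents. \<phi>0 i = Xhat1 i - \<beta> i * (t1 - \<mu>)) \<and>
    ((\<forall>i\<in>agents. prob_space.variance M (X i) > 0) \<longrightarrow>
       (\<forall>i\<in>agents.
          h i = \<bar>\<beta> i\<bar> / sqrt (\<sigma>\<^sup>2 * (\<beta> i)\<^sup>2 + \<gamma> i i) \<and>
          g i i = \<gamma> i i / (\<sigma>\<^sup>2 * (\<beta> i)\<^sup>2 + \<gamma> i i) \<and>
          \<bar>\<phi>1 i\<bar> = sqrt (\<sigma>\<^sup>2 * (\<beta> i)\<^sup>2 + \<gamma> i i) \<and>
          (\<forall>j\<in>agents. i \<noteq> j \<longrightarrow>
             \<bar>g i j\<bar> = \<bar>\<gamma> i j\<bar> /
               sqrt ((\<sigma>\<^sup>2 * (\<beta> i)\<^sup>2 + \<gamma> i i) * (\<sigma>\<^sup>2 * (\<beta> j)\<^sup>2 + \<gamma> j j))))) \<and>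
    ((\<forall>i\<in>agents. Xhat1 i \<noteq> Xhat2 i) \<longrightarrow>
       (\<forall>i\<in>agents.
          \<phi>1 i = sgn (\<beta> i) * sqrt (\<sigma>\<^sup>2 * (\<beta> i)\<^sup>2 + \<gamma> i i) \<and>
          (\<forall>j\<in>agents. i \<noteq> j \<longrightarrow>
             g i j = sgn (\<beta> i * \<beta> j) * \<gamma> i j /
               sqrt ((\<sigma>\<^sup>2 * (\<beta> i)\<^sup>2 + \<gamma> i i) * (\<sigma>\<^sup>2 * (\<beta> j)\<^sup>2 + \<gamma> j j)))))"
proof -
  let ?A = "affine_outcome \<mu> h \<phi>0 \<phi>1 \<theta>' \<epsilon>"
  note can = assms(6) and law = assms(8)
  note outcome = affine_outcome_moments[OF can \<open>\<sigma> > 0\<close>, of _ _ \<phi>0 \<phi>1]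
  have G: "gaussian_process M state_agents (with_state \<theta> X)"
    using assms(3) by (simp add: gaussian_BCE_def)
  have meas_M: "with_state \<theta> X t \<in> borel_measurable M" if "t \<in> state_agents" for t
    using gaussian_process_borel_measurable[OF G that] .
  have meas_N: "with_state \<theta>' ?A t \<in> borel_measurable N" if "t \<in> state_agents" for t
    using that canonical_information_state(1)[OF can \<open>\<sigma> > 0\<close>] outcome(1)
    by (auto simp: state_agents_def with_state_def)
  have mem: "None \<in> state_agents" "Some i \<in> state_agents" if "i \<in> agents" for i
    using that by (simp_all add: state_agents_def)
  have mean: "integral\<^sup>L M (X i) = \<phi>0 i" if "i \<in> agents" for i
    using same_law_expectation[OF law mem(2)[OF that] meas_M meas_N] outcome(2)[OF that that]
    by (simp add: with_state_def)
  have cov_state: "covariance M (X i) \<theta> = \<phi>1 i * h i * \<sigma>\<^sup>2" if "i \<in> agents" for i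
    using same_law_covariance[OF law mem(2,1)[OF that] meas_M meas_N] outcome(3)[OF that that]
    by (simp add: with_state_def)
  have cov: "covariance M (X i) (X j) = \<phi>1 i * \<phi>1 j * (\<sigma>\<^sup>2 * h i * h j + g i j)"
    if "i \<in> agents" "j \<in> agents" for i j
    using same_law_covariance[OF law mem(2)[OF that(1)] mem(2)[OF that(2)] meas_M meas_N]
      outcome(4)[OF that] by (simp add: with_state_def)
  have Xhat: "Xhat1 i = \<phi>0 i + \<phi>1 i * h i * (t1 - \<mu>)" "Xhat2 i = \<phi>0 i + \<phi>1 i * h i * (t2 - \<mu>)"
    if "i \<in> agents" for i
    using \<open>\<sigma> > 0\<close> that by (simp_all add: Xhat1_def Xhat2_def cond_mean_def mean cov_state)
  have \<beta>: "\<beta> i = \<phi>1 i * h i" if "i \<in> agents" for i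
  proof -
    \<comment> \<open>The intercept and \<open>\<mu>\<close> cancel in the difference, so
      \<open>\<beta> i\<close> is the slope of the conditional mean in the state.\<close>
    have "Xhat1 i - Xhat2 i = \<phi>1 i * h i * (t1 - t2)"
      using that by (simp add: Xhat algebra_simps)
    then show ?thesis
      using \<open>t1 \<noteq> t2\<close> by (simp add: \<beta>_def)
  qed
  \<comment> \<open>Conditioning on the state subtracts exactly the covariance that the state
    contributes, leaving only that of the noise.\<close>
  have \<gamma>: "\<gamma> i j = \<phi>1 i * \<phi>1 j * g i j" if "i \<in> agents" "j \<in> agents" for i j
    using \<open>\<sigma> > 0\<close> that
    by (simp add: \<gamma>_def cond_cov_def cov cov_state field_simps power2_eq_square)
  have unit: "\<sigma>\<^sup>2 * (h i)\<^sup>2 + g i i = 1" if "i \<in> agents" for i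
    using canonical_information_unit_variance[OF can \<open>\<sigma> > 0\<close> that] .
  have h: "h i \<ge> 0" if "i \<in> agents" for i
    using can that by (simp add: canonical_information_def)
  have scale: "\<sigma>\<^sup>2 * (\<beta> i)\<^sup>2 + \<gamma> i i = (\<phi>1 i)\<^sup>2" if "i \<in> agents" for i
  proof -
    have "\<sigma>\<^sup>2 * (\<beta> i)\<^sup>2 + \<gamma> i i = (\<phi>1 i)\<^sup>2 * (\<sigma>\<^sup>2 * (h i)\<^sup>2 + g i i)"
      using that by (simp add: \<beta> \<gamma> power2_eq_square algebra_simps)
    then show ?thesis
      using that by (simp add: unit)
  qed
  have part_i: "\<phi>0 i = Xhat1 i - \<beta> i * (t1 - \<mu>)" if "i \<in> agents" for i
    using that by (simp add: Xhat \<beta>)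
  \<comment> \<open>Here \<open>h i\<close> may vanish; then \<open>\<beta> i = 0\<close> carries no
    sign, and \<open>scale\<close> determines \<open>\<phi>1 i\<close> only in absolute
    value.\<close>
  have part_ii: "h i = \<bar>\<beta> i\<bar> / sqrt (\<sigma>\<^sup>2 * (\<beta> i)\<^sup>2 + \<gamma> i i) \<and>
      g i i = \<gamma> i i / (\<sigma>\<^sup>2 * (\<beta> i)\<^sup>2 + \<gamma> i i) \<and>
      \<bar>\<phi>1 i\<bar> = sqrt (\<sigma>\<^sup>2 * (\<beta> i)\<^sup>2 + \<gamma> i i) \<and>
      (\<forall>j\<in>agents. i \<noteq> j \<longrightarrow> \<bar>g i j\<bar> = \<bar>\<gamma> i j\<bar> /
        sqrt ((\<sigma>\<^sup>2 * (\<beta> i)\<^sup>2 + \<gamma> i i) * (\<sigma>\<^sup>2 * (\<beta> j)\<^sup>2 + \<gamma> j j)))"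
    if var: "\<forall>i\<in>agents. prob_space.variance M (X i) > 0" and i: "i \<in> agents" for i
  proof -
    \<comment> \<open>The variance of \<open>X k\<close> has the factor \<open>\<phi>1 k\<close>
      squared, so its positivity excludes zero.\<close>
    have nz: "\<phi>1 k \<noteq> 0" if "k \<in> agents" for k
      using bspec[OF var that] variance_eq_covariance[of M "X k"] cov[OF that that] by auto
    show ?thesis
      using i h[OF i] nz
      \<comment> \<open>The radicands first become squares of \<open>\<phi>1\<close>, their roots
        absolute values; only then are \<open>\<beta>\<close> and \<open>\<gamma>\<close> expanded,
        as \<open>scale\<close> is stated in terms of them.\<close>
      by (simp add: scale real_sqrt_mult) (simp add: \<beta> \<gamma> abs_mult power2_eq_square)
  qed
  have part_iii: "\<phi>1 i = sgn (\<beta> i) * sqrt (\<sigma>\<^sup>2 * (\<beta> i)\<^sup>2 + \<gamma> i i) \<and>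
      (\<forall>j\<in>agents. i \<noteq> j \<longrightarrow> g i j = sgn (\<beta> i * \<beta> j) * \<gamma> i j /
        sqrt ((\<sigma>\<^sup>2 * (\<beta> i)\<^sup>2 + \<gamma> i i) * (\<sigma>\<^sup>2 * (\<beta> j)\<^sup>2 + \<gamma> j j)))"
    if ne: "\<forall>i\<in>agents. Xhat1 i \<noteq> Xhat2 i" and i: "i \<in> agents" for i
  proof -
    have nz: "\<phi>1 k \<noteq> 0" and sgn_\<beta>: "sgn (\<beta> k) = sgn (\<phi>1 k)" if k: "k \<in> agents" for k
    proof -
      \<comment> \<open>Were this product zero, both conditional means would equal
        \<open>\<phi>0 k\<close>. With \<open>h k \<ge> 0\<close> it forces \<open>h k > 0\<close>,
        so \<open>\<beta> k\<close> inherits the sign of \<open>\<phi>1 k\<close>.\<close>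
      have "\<phi>1 k * h k \<noteq> 0"
        using ne k by (auto simp: Xhat)
      then show "\<phi>1 k \<noteq> 0" "sgn (\<beta> k) = sgn (\<phi>1 k)"
        using h[OF k] k by (auto simp: \<beta> sgn_mult)
    qed
    have "g i j = sgn (\<beta> i * \<beta> j) * \<gamma> i j /
        sqrt ((\<sigma>\<^sup>2 * (\<beta> i)\<^sup>2 + \<gamma> i i) * (\<sigma>\<^sup>2 * (\<beta> j)\<^sup>2 + \<gamma> j j))" if j: "j \<in> agents" for j
      using nz[OF i] nz[OF j] i j
      \<comment> \<open>The signs turn the factor \<open>\<phi>1 i * \<phi>1 j\<close> of
        \<open>\<gamma> i j\<close> into its absolute value, which cancels against the
        denominator.\<close>
      by (simp add: scale sgn_mult sgn_\<beta> real_sqrt_mult) (simp add: \<gamma> sgn_if)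
    then show ?thesis
      using i by (simp add: scale sgn_\<beta> sgn_mult_abs)
  qed
  show ?thesis
    using part_i part_ii part_iii by blast
qed

end
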